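(* Let $\langle I,\trianglelefteq\rangle$ be an infinite chain (totally ordered set). Then the lattice $\mathbf{Co}(I)$ of all order-convex subsets of $I$, ordered by inclusion, has no lattice embedding into any $\aleph_0$-complete, $\aleph_0$-upper continuous, and $\aleph_0$-lower continuous lattice.
   Context: A subset $X$ of a chain $I$ is order-convex if $x\trianglelefteq z\trianglelefteq y$ with $x,y\in X$ implies $z\in X$ (the empty set is order-convex). A lattice is $\aleph_0$-complete if every at most countable subset has a join and a meet. A lattice $L$ is $\aleph_0$-lower continuous if $a\vee\bigwedge X=\bigwedge\{a\vee x\mid x\in X\}$ for every $a\in L$ and every at most countable downward directed $X\subseteq L$ such that $\bigwedge X$ exists; $\aleph_0$-upper continuity is the dual notion. A lattice embedding is an injective map preserving binary joins and meets. *)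

theory Defs
  imports "HOL-Library.Countable_Complete_Lattices" "HOL-Library.Lub_Glb"
begin

definition order_convex :: "'a::linorder set \<Rightarrow> bool" where
  "order_convex X \<longleftrightarrow> (\<forall>x\<in>X. \<forall>y\<in>X. \<forall>z. x \<le> z \<and> z \<le> y \<longrightarrow> z \<in> X)"

typedef (overloaded) 'a co = "{X :: 'a::linorder set. order_convex X}"
  morphisms set_of_co Abs_co
  by (rule exI [of _ "{}"]) (simp add: order_convex_def)

setup_lifting type_definition_co

text \<open>
  The order is inclusion and the meet is intersection. The join is the convex hull of the
  union, since the union of two order-convex sets need not be order-convex.
\<close>

instantiation co :: (linorder) lattice
begin

lift_definition less_eq_co :: "'a co \<Rightarrow> 'a co \<Rightarrow> bool" is "(\<subseteq>)" .

lift_definition less_co :: "'a co \<Rightarrow> 'a co \<Rightarrow> bool" is "(\<subset>)" .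

lift_definition inf_co :: "'a co \<Rightarrow> 'a co \<Rightarrow> 'a co" is "(\<inter>)"
  unfolding order_convex_def by blast

lift_definition sup_co :: "'a co \<Rightarrow> 'a co \<Rightarrow> 'a co" is
  "\<lambda>X Y. {z. \<exists>x \<in> X \<union> Y. \<exists>y \<in> X \<union> Y. x \<le> z \<and> z \<le> y}"
  unfolding order_convex_def by (simp, meson order_trans)

instance
proof
  fix X Y Z :: "'a co"
  show "X < Y \<longleftrightarrow> X \<le> Y \<and> \<not> Y \<le> X" by transfer blast
  show "X \<le> X" by transfer blast
  show "X \<le> Y \<Longrightarrow> Y \<le> Z \<Longrightarrow> X \<le> Z" by transfer blast
  show "X \<le> Y \<Longrightarrow> Y \<le> X \<Longrightarrow> X = Y" by transfer blast
  show "inf X Y \<le> X" by transfer blast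
  show "inf X Y \<le> Y" by transfer blast
  show "X \<le> Y \<Longrightarrow> X \<le> Z \<Longrightarrow> X \<le> inf Y Z" by transfer blast
  show "X \<le> sup X Y" by transfer auto
  show "Y \<le> sup X Y" by transfer auto
  show "Y \<le> X \<Longrightarrow> Z \<le> X \<Longrightarrow> sup Y Z \<le> X"
    unfolding less_eq_co.rep_eq sup_co.rep_eq using set_of_co [of X]
    by (simp add: order_convex_def subset_iff) (metis Un_iff)
qed

end

definition downward_directed :: "'a::order set \<Rightarrow> bool" where
  "downward_directed X \<longleftrightarrow> X \<noteq> {} \<and> (\<forall>x\<in>X. \<forall>y\<in>X. \<exists>z\<in>X. z \<le> x \<and> z \<le> y)"

definition upward_directed :: "'a::order set \<Rightarrow> bool" where
  "upward_directed X \<longleftrightarrow> X \<noteq> {} \<and> (\<forall>x\<in>X. \<forall>y\<in>X. \<exists>z\<in>X. x \<le> z \<and> y \<le> z)"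

text \<open>
  Continuity is defined for arbitrary lattices: whenever \<open>m\<close> is the meet of \<open>X\<close>,
  the meet of all \<open>a \<squnion> x\<close> with \<open>x \<in> X\<close> exists and equals \<open>a \<squnion> m\<close>; dually for joins.
\<close>

definition aleph0_lower_continuous :: "'a::lattice itself \<Rightarrow> bool" where
  "aleph0_lower_continuous _ \<longleftrightarrow>
    (\<forall>(a::'a) X m. countable X \<and> downward_directed X \<and> isGlb UNIV X m \<longrightarrow>
      isGlb UNIV ((\<lambda>x. sup a x) ` X) (sup a m))"

definition aleph0_upper_continuous :: "'a::lattice itself \<Rightarrow> bool" where
  "aleph0_upper_continuous _ \<longleftrightarrow>
    (\<forall>(a::'a) X m. countable X \<and> upward_directed X \<and> isLub UNIV X m \<longrightarrow>
      isLub UNIV ((\<lambda>x. inf a x) ` X) (inf a m))"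

definition lattice_embedding :: "('a::lattice \<Rightarrow> 'b::lattice) \<Rightarrow> bool" where
  "lattice_embedding f \<longleftrightarrow>
    inj f \<and> (\<forall>x y. f (sup x y) = sup (f x) (f y)) \<and> (\<forall>x y. f (inf x y) = inf (f x) (f y))"

end

theory Submission
  imports Defs
begin

text \<open>
  Choose a strictly monotone sequence of points \<open>x\<^sub>0, x\<^sub>1, \<dots>\<close> in the chain, and let \<open>J k n\<close> be
  the image of the segment between \<open>x\<^sub>k\<close> and \<open>x\<^sub>n\<close>, and \<open>V k\<close> the join of the increasing sequence
  \<open>J k n\<close>, \<open>n \<ge> k\<close>. By upper continuity \<open>J 0 n\<close> and \<open>V (n + 1)\<close> meet in \<open>z\<close>, the image of the empty
  set; applying upper continuity to \<open>V 0\<close> gives \<open>\<And>\<^sub>k V k = z\<close>. But \<open>J 0 0 \<squnion> V k = V 0\<close> for all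
  \<open>k\<close>, so lower continuity yields \<open>V 0 = J 0 0 \<squnion> z = J 0 0\<close>, although \<open>J 0 1 \<le> V 0\<close>.
\<close>

lemma isLub_ccSup:
  fixes A :: "'b::countable_complete_lattice set"
  assumes "countable A"
  shows "isLub UNIV A (Sup A)"
  using assms
  by (auto simp: isLub_def leastP_def isUb_def setle_def setge_def intro: ccSup_upper ccSup_least)

lemma isGlb_ccInf:
  fixes A :: "'b::countable_complete_lattice set"
  assumes "countable A"
  shows "isGlb UNIV A (Inf A)"
  using assms
  by (auto simp: isGlb_def greatestP_def isLb_def setle_def setge_def intro: ccInf_lower ccInf_greatest)

lemma isLub_eq_ccSup:
  fixes A :: "'b::countable_complete_lattice set"
  assumes "countable A" "isLub UNIV A s"
  shows "s = Sup A"
  using isLub_ccSup[OF assms(1)] assms(2)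
  by (auto simp: isLub_def leastP_def setge_def intro!: antisym)

lemma isGlb_eq_ccInf:
  fixes A :: "'b::countable_complete_lattice set"
  assumes "countable A" "isGlb UNIV A s"
  shows "s = Inf A"
  using isGlb_ccInf[OF assms(1)] assms(2)
  by (auto simp: isGlb_def greatestP_def setle_def intro!: antisym)

text \<open>Countable completeness supplies the join that upper continuity asks for, and least upper
  bounds are unique, so the relational definition becomes an equation.\<close>

lemma inf_ccSup_directed:
  fixes a :: "'b::countable_complete_lattice"
  assumes "aleph0_upper_continuous TYPE('b)" "countable A" "upward_directed A"
  shows "inf a (Sup A) = Sup (inf a ` A)"
  using assms isLub_ccSup[of A] isLub_eq_ccSup[of "inf a ` A"]
  unfolding aleph0_upper_continuous_def by (metis countable_image)

lemma sup_ccInf_directed: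
  fixes a :: "'b::countable_complete_lattice"
  assumes "aleph0_lower_continuous TYPE('b)" "countable A" "downward_directed A"
  shows "sup a (Inf A) = Inf (sup a ` A)"
  using assms isGlb_ccInf[of A] isGlb_eq_ccInf[of "sup a ` A"]
  unfolding aleph0_lower_continuous_def by (metis countable_image)

text \<open>The hypotheses keep only what the argument needs from segments, so increasing and
  decreasing sequences are treated alike. \<open>J k n\<close> with \<open>n < k\<close> is
  unconstrained, hence the index sets \<open>{k..}\<close>.\<close>

lemma segments_collapse:
  fixes J :: "nat \<Rightarrow> nat \<Rightarrow> 'b::countable_complete_lattice"
  assumes upper: "aleph0_upper_continuous TYPE('b)"
    and lower: "aleph0_lower_continuous TYPE('b)"
    and mono: "\<And>k i j n. \<lbrakk>k \<le> i; i \<le> j; j \<le> n\<rbrakk> \<Longrightarrow> J i j \<le> J k n"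
    and join: "\<And>k n. k \<le> n \<Longrightarrow> sup (J 0 0) (J k n) = J 0 n"
    and disjoint: "\<And>n m. n < m \<Longrightarrow> inf (J 0 n) (J (Suc n) m) = z"
  shows "J 0 1 \<le> J 0 0"
proof -
  define V where "V k = Sup (J k ` {k..})" for k
  have J_le_V: "J k n \<le> V k" if "k \<le> n" for k n
    unfolding V_def using that by (intro ccSup_upper) auto
  have V_least: "V k \<le> b" if "\<And>n. k \<le> n \<Longrightarrow> J k n \<le> b" for k b
    unfolding V_def using that by (intro ccSup_least) auto
  have directed: "upward_directed (J k ` {k..})" for k
    unfolding upward_directed_def
  proof (intro conjI ballI)
    fix u v
    assume "u \<in> J k ` {k..}" "v \<in> J k ` {k..}"
    then obtain i j where "k \<le> i" "u = J k i" "k \<le> j" "v = J k j"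
      by auto
    then have "J k (max i j) \<in> J k ` {k..} \<and> u \<le> J k (max i j) \<and> v \<le> J k (max i j)"
      by (auto intro!: mono)
    then show "\<exists>w\<in>J k ` {k..}. u \<le> w \<and> v \<le> w"
      by blast
  qed auto
  \<comment> \<open>Upper continuity as a rule: a bound for every \<open>inf a (J k n)\<close>
    bounds \<open>inf a (V k)\<close>.\<close>
  have inf_V: "inf a (V k) \<le> b" if "\<And>n. k \<le> n \<Longrightarrow> inf a (J k n) \<le> b" for a b k
  proof -
    have "inf a (V k) = Sup (inf a ` J k ` {k..})"
      unfolding V_def by (rule inf_ccSup_directed[OF upper _ directed]) simp
    also have "\<dots> \<le> b"
      using that by (intro ccSup_least) auto
    finally show ?thesis .
  qed
  have V_decreasing: "V l \<le> V k" if "k \<le> l" for k l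
  proof (rule V_least)
    fix n
    assume "l \<le> n"
    with that show "J l n \<le> V k"
      using mono[of k l n n] J_le_V[of k n] by (meson order.trans le_refl)
  qed
  define w where "w = Inf (range V)"
  have w_le: "w \<le> V k" for k
    unfolding w_def by (intro ccInf_lower) auto
  \<comment> \<open>Since \<open>w\<close> lies below \<open>V 0\<close>, this meet is
    \<open>w\<close> itself; writing it so lets \<open>inf_V\<close> split \<open>V 0\<close>, and
    then \<open>V (Suc n)\<close>, into segments that \<open>disjoint\<close> separates.\<close>
  have "inf w (V 0) \<le> z"
  proof (rule inf_V)
    fix n
    have "inf w (J 0 n) \<le> inf (J 0 n) (V (Suc n))"
      using w_le[of "Suc n"] by (simp add: le_infI1)
    also have "\<dots> \<le> z"
      using disjoint by (intro inf_V) (simp add: Suc_le_eq)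
    finally show "inf w (J 0 n) \<le> z" .
  qed
  then have "w \<le> z"
    using w_le[of 0] by (simp add: inf_absorb1)
  also have "z \<le> J 0 0"
    using disjoint[of 0 1] by (metis inf_le1 zero_less_one)
  finally have "w \<le> J 0 0" .
  have "J 0 1 \<le> sup (J 0 0) (V k)" for k
  proof -
    \<comment> \<open>The right end must be at least 1 to cover \<open>J 0 1\<close> and at least
      \<open>k\<close> for \<open>join\<close> to apply.\<close>
    have "J 0 1 \<le> J 0 (max 1 k)"
      by (intro mono) auto
    also have "\<dots> = sup (J 0 0) (J k (max 1 k))"
      by (simp add: join)
    also have "\<dots> \<le> sup (J 0 0) (V k)"
      by (intro sup_mono J_le_V) auto
    finally show ?thesis .
  qed
  then have "J 0 1 \<le> Inf (sup (J 0 0) ` range V)"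
    by (intro ccInf_greatest) auto
  also have "\<dots> = sup (J 0 0) w"
  proof -
    have "downward_directed (range V)"
      unfolding downward_directed_def
    proof (intro conjI ballI)
      fix u v
      assume "u \<in> range V" "v \<in> range V"
      then obtain i j where "u = V i" "v = V j"
        by auto
      then have "V (max i j) \<le> u \<and> V (max i j) \<le> v"
        by (auto intro!: V_decreasing)
      then show "\<exists>w\<in>range V. w \<le> u \<and> w \<le> v"
        by blast
    qed auto
    then show ?thesis
      unfolding w_def by (intro sup_ccInf_directed[OF lower, symmetric]) auto
  qed
  also have "\<dots> = J 0 0"
    using \<open>w \<le> J 0 0\<close> by (simp add: sup_absorb1)
  finally show ?thesis .
qed

text \<open>Unordered endpoints spare a separate dual argument for decreasing sequences.\<close>

lift_definition segment :: "'a::linorder \<Rightarrow> 'a \<Rightarrow> 'a co" is "\<lambda>a b. {min a b..max a b}"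
  unfolding order_convex_def by auto

lift_definition empty_co :: "'a::linorder co" is "{}"
  by (simp add: order_convex_def)

lemma segment_mono:
  assumes "a \<in> set_of_co (segment c d)" "b \<in> set_of_co (segment c d)"
  shows "segment a b \<le> segment c d"
  using assms by transfer (auto simp: min_le_iff_disj le_max_iff_disj)

text \<open>Joins are convex hulls, so adding the point \<open>a\<close> also fills the gap between
  \<open>a\<close> and \<open>b\<close>.\<close>

lemma sup_segment:
  assumes "b \<in> set_of_co (segment a c)"
  shows "sup (segment a a) (segment b c) = segment a c"
proof (rule antisym)
  show "sup (segment a a) (segment b c) \<le> segment a c"
    using assms by (intro sup_least segment_mono) (auto simp: segment.rep_eq)
  show "segment a c \<le> sup (segment a a) (segment b c)"
    by transfer (auto simp: min_def max_def)
qed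

lemma infinite_linorder_monoseq:
  assumes "infinite (UNIV :: 'a::linorder set)"
  obtains x :: "nat \<Rightarrow> 'a::linorder" where "inj x" "monoseq x"
proof -
  obtain s :: "nat \<Rightarrow> 'a" where "inj s"
    using assms infinite_countable_subset by blast
  obtain r :: "nat \<Rightarrow> nat" where "strict_mono r" "monoseq (\<lambda>n. s (r n))"
    using seq_monosub by blast
  moreover have "inj (\<lambda>n. s (r n))"
    using inj_compose[OF \<open>inj s\<close> strict_mono_imp_inj_on[OF \<open>strict_mono r\<close>]] by (simp add: o_def)
  ultimately show thesis
    using that by blast
qed

lemma monoseq_in_segment:
  fixes x :: "nat \<Rightarrow> 'a::linorder"
  assumes "monoseq x" "k \<le> i" "i \<le> n"
  shows "x i \<in> set_of_co (segment (x k) (x n))"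
  using assms unfolding monoseq_def
  by (auto simp: segment.rep_eq min_le_iff_disj le_max_iff_disj)

text \<open>Monotonicity puts the segments on opposite sides; injectivity keeps the facing ends
  \<open>x n\<close> and \<open>x k\<close> apart.\<close>

lemma inf_segment_monoseq:
  fixes x :: "nat \<Rightarrow> 'a::linorder"
  assumes "inj x" "monoseq x" "i \<le> n" "n < k" "k \<le> m"
  shows "inf (segment (x i) (x n)) (segment (x k) (x m)) = empty_co"
proof -
  have "x n \<noteq> x k"
    using assms by (auto dest: injD)
  consider "x i \<le> x n" "x n \<le> x k" "x k \<le> x m"
    | "x n \<le> x i" "x k \<le> x n" "x m \<le> x k"
    using assms unfolding monoseq_def by (metis less_imp_le)
  then have "set_of_co (segment (x i) (x n)) \<inter> set_of_co (segment (x k) (x m)) = {}"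
    using \<open>x n \<noteq> x k\<close>
    by cases (auto simp: segment.rep_eq min_absorb1 min_absorb2 max_absorb1 max_absorb2)
  then show ?thesis
    by (simp flip: set_of_co_inject add: inf_co.rep_eq empty_co.rep_eq)
qed

theorem corollary12p5:
  assumes "infinite (UNIV :: 'a::linorder set)"
    and "aleph0_upper_continuous TYPE('b::countable_complete_lattice)"
    and "aleph0_lower_continuous TYPE('b)"
  shows "\<nexists>f :: 'a co \<Rightarrow> 'b. lattice_embedding f"
proof
  assume "\<exists>f :: 'a co \<Rightarrow> 'b. lattice_embedding f"
  then obtain f :: "'a co \<Rightarrow> 'b" where "inj f"
    and f_sup: "\<And>X Y. f (sup X Y) = sup (f X) (f Y)"
    and f_inf: "\<And>X Y. f (inf X Y) = inf (f X) (f Y)"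
    unfolding lattice_embedding_def by blast
  \<comment> \<open>The order is definable from meets, so an injective meet-preserving map also
    reflects it.\<close>
  have f_le_iff: "f X \<le> f Y \<longleftrightarrow> X \<le> Y" for X Y
    using \<open>inj f\<close> by (metis f_inf inf.absorb_iff1 injD)
  obtain x :: "nat \<Rightarrow> 'a" where x: "inj x" "monoseq x"
    using infinite_linorder_monoseq[OF assms(1)] .
  have "f (segment (x 0) (x 1)) \<le> f (segment (x 0) (x 0))"
  proof (rule segments_collapse[OF assms(2,3), where J = "\<lambda>k n. f (segment (x k) (x n))"])
    show "f (segment (x i) (x j)) \<le> f (segment (x k) (x n))"
      if "k \<le> i" "i \<le> j" "j \<le> n" for k i j n
      unfolding f_le_iff using that by (intro segment_mono monoseq_in_segment x) auto
    show "sup (f (segment (x 0) (x 0))) (f (segment (x k) (x n))) = f (segment (x 0) (x n))"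
      if "k \<le> n" for k n
      using that by (simp flip: f_sup add: sup_segment monoseq_in_segment x)
    show "inf (f (segment (x 0) (x n))) (f (segment (x (Suc n)) (x m))) = f empty_co"
      if "n < m" for n m
      using that by (simp flip: f_inf add: inf_segment_monoseq x)
  qed
  then have "segment (x 0) (x 1) \<le> segment (x 0) (x 0)"
    by (simp only: f_le_iff)
  \<comment> \<open>The right-hand segment is the singleton of \<open>x 0\<close>, and
    \<open>x 1\<close> lies in the left-hand one.\<close>
  then have "x 1 = x 0"
    using monoseq_in_segment[OF x(2), of 0 1 1]
    by (auto simp: less_eq_co.rep_eq segment.rep_eq[of "x 0" "x 0"])
  with \<open>inj x\<close> show False
    by (auto dest: injD)
qed

end
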